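(* Let $N\ge 1$ be an integer, let $d,m\ge 1$ be divisors of $N$, and let $t,n\in\mathbb{Z}$ with $0\le t\le d-1$. Let $L\subseteq\mathbb{Z}^2$ be the subgroup generated by the four vectors $$u_1=(d,0),\quad u_2=\Big(t,\frac{N}{d}\Big),\quad u_3=(m,0),\quad u_4=\Big(-n,\frac{N}{m}\Big).$$ Then $$[\mathbb{Z}^2:L]=\gcd\!\left(N\frac{d}{m},\ N\frac{m}{d},\ N\Big(\frac{t}{m}+\frac{n}{d}\Big)\right),$$ and moreover $$\mathbb{Z}^2/L\;\cong\;\mathbb{Z}/e_1\mathbb{Z}\times\mathbb{Z}/e_2\mathbb{Z},$$ where $e_1,e_2$ are the positive integers determined by $$e_1=\gcd\!\left(d,m,\frac{N}{d},\frac{N}{m},t,n\right),\qquad e_1e_2=\gcd\!\left(N\frac{m}{d},\ N\frac{d}{m},\ N\Big(\frac{t}{m}+\frac{n}{d}\Big)\right).$$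
   Context: The gcd is non-negative, with $\gcd(a,0)=|a|$. Since $d$ and $m$ divide $N$, all arguments of the gcds are integers. (The quotient $\mathbb{Z}^2/L$ labels the inequivalent massive vacua of the $\mathcal{N}=1^\ast$ theory $(\mathrm{SU}(N)/\mathbb{Z}_m)_n$ on a circle that project to the lattice labelled by $(d,t)$; this interpretation is not needed for the claim.) *)

theory Defs
  imports Complex_Main "HOL-Algebra.Elementary_Groups"
begin

abbreviation Z2 :: "(int \<times> int) monoid" where
  "Z2 \<equiv> integer_group \<times>\<times> integer_group"

definition vacua_lattice :: "int \<Rightarrow> int \<Rightarrow> int \<Rightarrow> int \<Rightarrow> int \<Rightarrow> (int \<times> int) set" where
  "vacua_lattice N d m t n =
     generate Z2 {(d, 0), (t, N div d), (m, 0), (- n, N div m)}"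

(* The numbers N(d/m), N(m/d), N(t/m + n/d), written with integer division, which is exact
   when d and m divide N (see minors_exact). *)
definition minors_gcd :: "int \<Rightarrow> int \<Rightarrow> int \<Rightarrow> int \<Rightarrow> int \<Rightarrow> int" where
  "minors_gcd N d m t n =
     Gcd {N * d div m, N * m div d, N div m * t + N div d * n}"

lemma minors_exact:
  fixes N d m t n :: int
  assumes "d dvd N" and "m dvd N" and "d \<ge> 1" and "m \<ge> 1"
  shows "rat_of_int (N * d div m) = rat_of_int N * (rat_of_int d / rat_of_int m)"
    and "rat_of_int (N * m div d) = rat_of_int N * (rat_of_int m / rat_of_int d)"
    and "rat_of_int (N div m * t + N div d * n)
           = rat_of_int N * (rat_of_int t / rat_of_int m + rat_of_int n / rat_of_int d)"
proof -
  have "m dvd N * d" "d dvd N * m"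
    using assms by simp_all
  then show "rat_of_int (N * d div m) = rat_of_int N * (rat_of_int d / rat_of_int m)"
    and "rat_of_int (N * m div d) = rat_of_int N * (rat_of_int m / rat_of_int d)"
    by (simp_all add: of_int_div)
  show "rat_of_int (N div m * t + N div d * n)
          = rat_of_int N * (rat_of_int t / rat_of_int m + rat_of_int n / rat_of_int d)"
    using assms by (simp add: of_int_div distrib_left)
qed

end

theory Submission
  imports Defs
begin

text \<open>Among all unimodular changes of basis, take one for which some vector of the lattice has the
  smallest possible positive first coordinate \<open>a\<close>. Minimality forces \<open>a\<close> to divide all coordinates
  of the lattice, which is therefore the product of \<open>a\<int>\<close> and some \<open>c\<int>\<close> with \<open>a\<close> dividing \<open>c\<close>.
  The gcd \<open>a\<close> of the coordinates and the gcd \<open>a c\<close> of the determinants of pairs of lattice vectors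
  are unimodular invariants, and can be computed on generators.
  Four of the six minors of the generators are the three listed ones (up to sign) and zero; the other
  two are \<open>N\<close>, which is redundant because \<open>(N d / m) (N m / d) = N\<^sup>2\<close>.\<close>

section \<open>Smith normal form for subgroups of the plane lattice\<close>

text \<open>Subgroups of Z^2 in coordinates, so that the normal form can be argued arithmetically;
  \<open>generate\<close> enters only through \<open>plane_lattice_generate\<close>.\<close>

locale plane_lattice =
  fixes L :: "(int \<times> int) set"
  assumes zero_mem: "(0, 0) \<in> L"
    and diff_mem: "(x, y) \<in> L \<Longrightarrow> (x', y') \<in> L \<Longrightarrow> (x - x', y - y') \<in> L"
begin

lemma uminus_mem: "(x, y) \<in> L \<Longrightarrow> (- x, - y) \<in> L"
  using diff_mem[OF zero_mem, of x y] by simp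

lemma add_mem: "(x, y) \<in> L \<Longrightarrow> (x', y') \<in> L \<Longrightarrow> (x + x', y + y') \<in> L"
  using diff_mem[OF _ uminus_mem, of x y x' y'] by simp

lemma scale_mem:
  assumes "(x, y) \<in> L"
  shows "(k * x, k * y) \<in> L"
proof (induction k rule: int_induct[where k = 0])
  case base
  then show ?case using zero_mem by simp
next
  case (step1 i)
  then show ?case using add_mem[OF step1(2) assms] by (simp add: algebra_simps)
next
  case (step2 i)
  then show ?case using diff_mem[OF step2(2) assms] by (simp add: algebra_simps)
qed

text \<open>Division with remainder by the least positive element shows that a subgroup of Z is
  principal. The value \<open>c = 0\<close> covers a trivial vertical part.\<close>

lemma vertical_part_principal:
  obtains c where "c \<ge> 0" "\<And>y. (0, y) \<in> L \<longleftrightarrow> c dvd y"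
proof (cases "\<exists>y. (0, y) \<in> L \<and> y \<noteq> 0")
  case False
  then have "(0, y) \<in> L \<longleftrightarrow> 0 dvd y" for y
    using zero_mem by auto
  then show ?thesis using that[of 0] by blast
next
  case True
  define P where "P k \<longleftrightarrow> k > 0 \<and> (0, int k) \<in> L" for k
  from True obtain y where y: "(0, y) \<in> L" "y \<noteq> 0" by blast
  have "P (nat \<bar>y\<bar>)"
    using y uminus_mem[OF y(1)] by (auto simp: P_def abs_if)
  define c where "c = Least P"
  have c: "c > 0" "(0, int c) \<in> L"
    using LeastI[of P, OF \<open>P _\<close>] unfolding c_def[symmetric] by (simp_all add: P_def)
  have "int c dvd z" if "(0, z) \<in> L" for z
  proof (rule ccontr)
    assume "\<not> int c dvd z"
    then have "z mod int c \<noteq> 0" by (simp add: dvd_eq_mod_eq_0)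
    moreover have "z mod int c \<ge> 0" using c(1) by simp
    ultimately have pos: "z mod int c > 0" by linarith
    have "(0, z mod int c) \<in> L"
      using diff_mem[OF that scale_mem[OF c(2), of "z div int c"]]
      by (simp add: minus_div_mult_eq_mod)
    then have "P (nat (z mod int c))"
      using pos by (simp add: P_def)
    then have "c \<le> nat (z mod int c)"
      unfolding c_def by (rule Least_le)
    moreover have "z mod int c < int c"
      using c(1) by simp
    ultimately show False using pos by linarith
  qed
  moreover have "(0, z) \<in> L" if "int c dvd z" for z
    using that scale_mem[OF c(2)] by (auto simp: mult.commute elim!: dvdE)
  ultimately show ?thesis using that[of "int c"] by auto
qed

text \<open>Any coordinate not divisible by \<open>a\<close> would leave a remainder that some
  unimodular change exposes as a smaller positive first coordinate. Hence \<open>b = a * k\<close>,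
  and the shear \<open>y - k * x\<close> moves \<open>(a, b)\<close> to \<open>(a, 0)\<close> and
  splits the lattice.\<close>

lemma diagonal_of_minimal:
  assumes v: "(a, b) \<in> L" and "a > 0"
    and least: "\<And>p q r s x y. p * s - q * r = 1 \<Longrightarrow> (x, y) \<in> L \<Longrightarrow> p * x + q * y > 0
                  \<Longrightarrow> a \<le> p * x + q * y"
  obtains k c where "c \<ge> 0" "a dvd c" "\<And>x y. (x, y) \<in> L \<longleftrightarrow> a dvd x \<and> c dvd y - k * x"
proof -
  have second: "a dvd b'" if "(a, b') \<in> L" for b'
  proof (rule ccontr)
    assume "\<not> a dvd b'"
    then have pos: "b' mod a > 0"
      using \<open>a > 0\<close> by (simp add: dvd_eq_mod_eq_0 order_less_le)
    \<comment> \<open>The row \<open>(- (b' div a), 1)\<close> extracts the remainder of the second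
      coordinate; the row \<open>(-1, 0)\<close> completes it to determinant 1.\<close>
    have eq: "(- (b' div a)) * a + 1 * b' = b' mod a"
      by (simp add: minus_div_mult_eq_mod[symmetric])
    have "a \<le> b' mod a"
      using least[of "- (b' div a)" 0 1 "-1" a b', OF _ that] pos eq by simp
    then show False using \<open>a > 0\<close> pos_mod_bound[of a b'] by linarith
  qed
  have first: "a dvd x" if "(x, y) \<in> L" for x y
  proof (rule ccontr)
    assume "\<not> a dvd x"
    then have pos: "x mod a > 0"
      using \<open>a > 0\<close> by (simp add: dvd_eq_mod_eq_0 order_less_le)
    have "(x mod a, y - (x div a) * b) \<in> L"
      using diff_mem[OF that scale_mem[OF v, of "x div a"]]
      by (simp add: minus_div_mult_eq_mod)
    then have "a \<le> x mod a"
      using least[of 1 1 0 0] pos by fastforce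
    then show False using \<open>a > 0\<close> pos_mod_bound[of a x] by linarith
  qed
  obtain c where c: "c \<ge> 0" "\<And>y. (0, y) \<in> L \<longleftrightarrow> c dvd y"
    by (rule vertical_part_principal) blast
  obtain k where k: "b = a * k"
    using second[OF v] by blast
  have "(0, c) \<in> L" using c by simp
  \<comment> \<open>Applied to \<open>(a, b + c)\<close>, which also has first coordinate
    \<open>a\<close>.\<close>
  then have "a dvd b + c"
    using add_mem[OF v] second by fastforce
  then have "a dvd c"
    unfolding k by (simp add: dvd_add_right_iff)
  moreover have "(x, y) \<in> L \<longleftrightarrow> a dvd x \<and> c dvd y - k * x" for x y
  proof (cases "a dvd x")
    case False
    then show ?thesis using first by blast
  next
    case True
    then obtain j where j: "x = a * j" ..
    \<comment> \<open>This is \<open>j\<close> times \<open>(a, b)\<close>; subtracting it reduces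
      membership to the vertical part.\<close>
    have jv: "(x, k * x) \<in> L"
      using scale_mem[OF v, of j] by (simp add: j k ac_simps)
    have "(x, y) \<in> L \<longleftrightarrow> (0, y - k * x) \<in> L"
      using diff_mem[OF _ jv, of x y] add_mem[OF _ jv, of 0 "y - k * x"] by auto
    then show ?thesis using c True by simp
  qed
  ultimately show ?thesis using that c(1) by blast
qed

text \<open>The set is the image of \<open>L\<close> under the matrix with rows
  \<open>(p, q)\<close> and \<open>(r, s)\<close>, expressed through the inverse matrix.\<close>

lemma unimodular_image:
  assumes "p * s - q * r = (1::int)"
  shows "plane_lattice {(x, y). (s * x - q * y, p * y - r * x) \<in> L}"
proof
  show "(0, 0) \<in> {(x, y). (s * x - q * y, p * y - r * x) \<in> L}"
    using zero_mem by simp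
next
  fix x y x' y'
  assume "(x, y) \<in> {(x, y). (s * x - q * y, p * y - r * x) \<in> L}"
    and "(x', y') \<in> {(x, y). (s * x - q * y, p * y - r * x) \<in> L}"
  then show "(x - x', y - y') \<in> {(x, y). (s * x - q * y, p * y - r * x) \<in> L}"
    using diff_mem[of "s * x - q * y" "p * y - r * x" "s * x' - q * y'" "p * y' - r * x'"]
    by (simp add: algebra_simps)
qed

text \<open>Only the ambient coordinates are changed: no basis of \<open>L\<close> is chosen, so a
  single unimodular matrix suffices. The zero lattice has \<open>a = c = 0\<close>.\<close>

theorem smith_normal_form:
  obtains p q r s a c where "p * s - q * r = (1::int)" "a \<ge> 0" "c \<ge> 0" "a dvd c"
    "\<And>x y. (x, y) \<in> L \<longleftrightarrow> a dvd p * x + q * y \<and> c dvd r * x + s * y"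
proof (cases "\<exists>x y. (x, y) \<in> L \<and> (x, y) \<noteq> (0, 0)")
  case False
  then have "(x, y) \<in> L \<longleftrightarrow> 0 dvd 1 * x + 0 * y \<and> 0 dvd 0 * x + 1 * y" for x y
    using zero_mem by auto
  then show ?thesis using that[of 1 1 0 0 0 0] by auto
next
  case True
  define P where "P k \<longleftrightarrow> k > 0 \<and> (\<exists>p q r s x y. p * s - q * r = 1 \<and> (x, y) \<in> L
                          \<and> p * x + q * y = int k)" for k
  have "\<exists>k. P k"
  proof -
    from True obtain x y where xy: "(x, y) \<in> L" "x \<noteq> 0 \<or> y \<noteq> 0" by auto
    have P1: "P (nat x')" if "(x', y') \<in> L" "x' > 0" for x' y'
    proof -
      have "1 * 1 - 0 * 0 = (1::int)" "1 * x' + 0 * y' = int (nat x')"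
        using that by simp_all
      then show ?thesis using that unfolding P_def by (metis zero_less_nat_eq)
    qed
    \<comment> \<open>A quarter turn makes the second coordinate the first.\<close>
    have P2: "P (nat y')" if "(x', y') \<in> L" "y' > 0" for x' y'
    proof -
      have "0 * 0 - 1 * (-1) = (1::int)" "0 * x' + 1 * y' = int (nat y')"
        using that by simp_all
      then show ?thesis using that unfolding P_def by (metis zero_less_nat_eq)
    qed
    consider "x > 0" | "- x > 0" | "y > 0" | "- y > 0"
      using xy(2) by linarith
    then show ?thesis
      using P1 P2 xy(1) uminus_mem[OF xy(1)] by cases blast+
  qed
  define a where "a = Least P"
  have "P a" unfolding a_def by (rule LeastI_ex) fact
  then obtain p q r s x0 y0 where a: "a > 0" and det: "p * s - q * r = 1"
    and v: "(x0, y0) \<in> L" "p * x0 + q * y0 = int a"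
    unfolding P_def by blast
  define L' where "L' = {(x, y). (s * x - q * y, p * y - r * x) \<in> L}"
  interpret M: plane_lattice L'
    unfolding L'_def by (rule unimodular_image[OF det])
  have L_iff: "(x, y) \<in> L \<longleftrightarrow> (p * x + q * y, r * x + s * y) \<in> L'" for x y
  proof -
    have "s * (p * x + q * y) - q * (r * x + s * y) = (p * s - q * r) * x"
      "p * (r * x + s * y) - r * (p * x + q * y) = (p * s - q * r) * y"
      by (simp_all add: algebra_simps)
    then show ?thesis unfolding L'_def det by simp
  qed
  have v': "(int a, r * x0 + s * y0) \<in> L'"
    using L_iff v by auto
  have least: "int a \<le> p' * x + q' * y"
    if "p' * s' - q' * r' = 1" "(x, y) \<in> L'" "p' * x + q' * y > 0" for p' q' r' s' x y
  proof -
    let ?x = "s * x - q * y" and ?y = "p * y - r * x"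
    have "(?x, ?y) \<in> L" using that(2) by (simp add: L'_def)
    \<comment> \<open>The product of the two matrices is again unimodular, so a value reached from
      \<open>L'\<close> is already reached from \<open>L\<close>, where \<open>a\<close> is
      minimal.\<close>
    moreover have "(p' * p + q' * r) * (r' * q + s' * s) - (p' * q + q' * s) * (r' * p + s' * r)
        = (p' * s' - q' * r') * (p * s - q * r)"
      by (simp add: algebra_simps)
    moreover have "(p' * p + q' * r) * ?x + (p' * q + q' * s) * ?y
        = (p * s - q * r) * (p' * x + q' * y)"
      by (simp add: algebra_simps)
    ultimately have "P (nat (p' * x + q' * y))"
      using that(1,3) det unfolding P_def
      by (metis int_nat_eq mult_1 order_less_imp_le zero_less_nat_eq)
    then have "a \<le> nat (p' * x + q' * y)"
      unfolding a_def by (rule Least_le)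
    then show ?thesis using that(3) by linarith
  qed
  obtain k c where kc: "c \<ge> 0" "int a dvd c"
    "\<And>x y. (x, y) \<in> L' \<longleftrightarrow> int a dvd x \<and> c dvd y - k * x"
  proof (rule M.diagonal_of_minimal[OF v'])
    show "int a > 0" using a by simp
  next
    fix p' q' r' s' x y
    assume "p' * s' - q' * r' = 1" "(x, y) \<in> L'" "p' * x + q' * y > 0"
    then show "int a \<le> p' * x + q' * y" by (rule least)
  qed (rule that)
  show ?thesis
  proof (rule that)
    \<comment> \<open>The shear is absorbed by subtracting \<open>k\<close> times the first row from
      the second.\<close>
    show "p * (s - k * q) - q * (r - k * p) = 1"
      using det by (simp add: algebra_simps)
    show "(x, y) \<in> L \<longleftrightarrow> int a dvd p * x + q * y \<and> c dvd (r - k * p) * x + (s - k * q) * y" for x y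
      unfolding L_iff kc(3) by (simp add: algebra_simps)
  qed (use kc in auto)
qed

end

section \<open>The quotient by a lattice in normal form\<close>

lemma carrier_Z2 [simp]: "carrier Z2 = UNIV"
  and mult_Z2 [simp]: "x \<otimes>\<^bsub>Z2\<^esub> y = (fst x + fst y, snd x + snd y)"
  and one_Z2 [simp]: "\<one>\<^bsub>Z2\<^esub> = (0, 0)"
  by (simp_all add: DirProd_def case_prod_beta)

lemma group_Z2: "group Z2"
  by (simp add: DirProd_group)

lemma inv_Z2 [simp]: "inv\<^bsub>Z2\<^esub> x = (- fst x, - snd x)"
  by (rule group.inv_equality[OF group_Z2]) simp_all

text \<open>First isomorphism theorem for the map that applies the matrix and reduces the
  coordinates modulo \<open>a\<close> and \<open>c\<close>; the index is read off from the carrier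
  of the target.\<close>

lemma quotient_of_normal_form:
  fixes p q r s :: int and a c :: nat
  assumes det: "p * s - q * r = 1" and "a > 0" "c > 0"
    and L: "\<And>x y. (x, y) \<in> L \<longleftrightarrow> int a dvd p * x + q * y \<and> int c dvd r * x + s * y"
  shows "Z2 Mod L \<cong> integer_mod_group a \<times>\<times> integer_mod_group c"
    and "card (rcosets\<^bsub>Z2\<^esub> L) = a * c"
proof -
  let ?G = "integer_mod_group a \<times>\<times> integer_mod_group c"
  let ?h = "\<lambda>(x, y). ((p * x + q * y) mod int a, (r * x + s * y) mod int c)"
  have hom: "?h \<in> hom Z2 ?G"
  proof (rule homI)
    fix u v
    have "p * (fst u + fst v) + q * (snd u + snd v) = (p * fst u + q * snd u) + (p * fst v + q * snd v)"
      "r * (fst u + fst v) + s * (snd u + snd v) = (r * fst u + s * snd u) + (r * fst v + s * snd v)"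
      by (simp_all add: algebra_simps)
    then show "?h (u \<otimes>\<^bsub>Z2\<^esub> v) = ?h u \<otimes>\<^bsub>?G\<^esub> ?h v"
      by (simp add: case_prod_beta mult_integer_mod_group mod_add_eq)
  qed (use assms(2,3) in \<open>auto simp: carrier_integer_mod_group\<close>)
  have ker: "kernel Z2 ?G ?h = L"
    by (auto simp: kernel_def L dvd_eq_mod_eq_0)
  have surj: "?h ` carrier Z2 = carrier ?G"
  proof
    show "?h ` carrier Z2 \<subseteq> carrier ?G"
      using assms(2,3) by (auto simp: carrier_integer_mod_group)
    show "carrier ?G \<subseteq> ?h ` carrier Z2"
    proof
      fix z assume z: "z \<in> carrier ?G"
      obtain u w where uw: "z = (u, w)" by (cases z)
      with z assms(2,3) have bounds: "0 \<le> u" "u < int a" "0 \<le> w" "w < int c"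
        by (auto simp: carrier_integer_mod_group)
      \<comment> \<open>The inverse matrix supplies a preimage of \<open>(u, w)\<close>.\<close>
      have "p * (s * u - q * w) + q * (p * w - r * u) = (p * s - q * r) * u"
        "r * (s * u - q * w) + s * (p * w - r * u) = (p * s - q * r) * w"
        by (simp_all add: algebra_simps)
      then have "z = ?h (s * u - q * w, p * w - r * u)"
        using det bounds uw by simp
      then show "z \<in> ?h ` carrier Z2" by (rule image_eqI) simp
    qed
  qed
  interpret group_hom Z2 ?G ?h
    by (rule group_hom.intro)
      (use hom group_Z2 in \<open>auto simp: group_hom_axioms_def DirProd_group\<close>)
  show iso: "Z2 Mod L \<cong> ?G"
    using FactGroup_iso[OF surj] ker by simp
  have "card (carrier (Z2 Mod L)) = card (carrier ?G)"
    using iso by (auto simp: is_iso_def iso_def intro: bij_betw_same_card)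
  then show "card (rcosets\<^bsub>Z2\<^esub> L) = a * c"
    using assms(2,3) by (simp add: FactGroup_def carrier_integer_mod_group card_cartesian_product)
qed

section \<open>Invariants of a generated lattice\<close>

lemma plane_lattice_generate: "plane_lattice (generate Z2 S)"
proof
  interpret group Z2 by (rule group_Z2)
  show "(0, 0) \<in> generate Z2 S"
    using generate.one[of Z2 S] by simp
  fix x y x' y'
  assume "(x, y) \<in> generate Z2 S" "(x', y') \<in> generate Z2 S"
  then show "(x - x', y - y') \<in> generate Z2 S"
    using generate.eng[of "(x, y)" Z2 S "inv\<^bsub>Z2\<^esub> (x', y')"] generate_m_inv_closed[of S "(x', y')"]
    by simp
qed

text \<open>The multiples of \<open>k\<close> form a subgroup, so divisibility of an integral linear
  form propagates from generators.\<close>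

lemma generate_dvd_additive:
  fixes f :: "int \<times> int \<Rightarrow> int"
  assumes "v \<in> generate Z2 S" and "\<And>u. u \<in> S \<Longrightarrow> k dvd f u"
    and f: "\<And>x y. f (x, y) = \<alpha> * x + \<beta> * y"
  shows "k dvd f v"
  using assms(1)
proof induction
  case one
  then show ?case by (simp add: f)
next
  case (incl h)
  then show ?case by (rule assms(2))
next
  case (inv h)
  have "f (inv\<^bsub>Z2\<^esub> h) = - f h" by (cases h) (simp add: f)
  then show ?case using assms(2)[OF inv] by simp
next
  case (eng g h)
  have "f (g \<otimes>\<^bsub>Z2\<^esub> h) = f g + f h" by (cases g; cases h) (simp add: f algebra_simps)
  then show ?case using eng by simp
qed

abbreviation det2 :: "int \<times> int \<Rightarrow> int \<times> int \<Rightarrow> int" where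
  "det2 u v \<equiv> fst u * snd v - snd u * fst v"

text \<open>The determinant is linear in each argument separately, so the linear case is used
  twice.\<close>

lemma generate_dvd_det2:
  assumes "u \<in> generate Z2 S" "v \<in> generate Z2 S"
    and S: "\<And>u v. u \<in> S \<Longrightarrow> v \<in> S \<Longrightarrow> k dvd det2 u v"
  shows "k dvd det2 u v"
proof (rule generate_dvd_additive[OF assms(2), where \<alpha> = "- snd u" and \<beta> = "fst u"])
  fix w assume w: "w \<in> S"
  show "k dvd det2 u w"
    by (rule generate_dvd_additive[OF assms(1), where \<alpha> = "snd w" and \<beta> = "- fst w"])
      (use S w in auto)
qed simp

text \<open>Both invariants are described by their divisors \<open>k\<close>, which makes them
  comparable with any gcd over the generators.\<close>

lemma normal_form_invariants:
  fixes p q r s a c :: int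
  assumes det: "p * s - q * r = 1" and "a dvd c"
    and L: "\<And>x y. (x, y) \<in> generate Z2 S \<longleftrightarrow> a dvd p * x + q * y \<and> c dvd r * x + s * y"
  shows dvd_content_iff: "k dvd a \<longleftrightarrow> (\<forall>(x, y) \<in> S. k dvd x \<and> k dvd y)"
    and dvd_minors_iff: "k dvd a * c \<longleftrightarrow> (\<forall>u \<in> S. \<forall>v \<in> S. k dvd det2 u v)"
proof -
  \<comment> \<open>This vector and the one in \<open>e2\<close> are the preimages of
    \<open>(a, 0)\<close> and \<open>(0, c)\<close> under the matrix; their determinant is
    \<open>a * c\<close>.\<close>
  have e1: "(s * a, - r * a) \<in> generate Z2 S"
  proof -
    have "p * (s * a) + q * (- r * a) = (p * s - q * r) * a" "r * (s * a) + s * (- r * a) = 0"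
      by (simp_all add: algebra_simps)
    then show ?thesis unfolding L det by simp
  qed
  have e2: "(- q * c, p * c) \<in> generate Z2 S"
  proof -
    have "p * (- q * c) + q * (p * c) = 0" "r * (- q * c) + s * (p * c) = (p * s - q * r) * c"
      by (simp_all add: algebra_simps)
    then show ?thesis unfolding L det by simp
  qed
  have coords: "a dvd x \<and> a dvd y" if "(x, y) \<in> S" for x y
  proof -
    have *: "a dvd p * x + q * y" "a dvd r * x + s * y"
      using generate.incl[OF that, of Z2] L \<open>a dvd c\<close> by (auto intro: dvd_trans)
    have "s * (p * x + q * y) - q * (r * x + s * y) = (p * s - q * r) * x"
      "p * (r * x + s * y) - r * (p * x + q * y) = (p * s - q * r) * y"
      by (simp_all add: algebra_simps)
    then show ?thesis
      using * det by (metis dvd_diff dvd_mult mult_1)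
  qed
  show "k dvd a \<longleftrightarrow> (\<forall>(x, y) \<in> S. k dvd x \<and> k dvd y)"
  proof
    assume "k dvd a"
    then show "\<forall>(x, y) \<in> S. k dvd x \<and> k dvd y"
      using coords by (auto intro: dvd_trans)
  next
    assume k: "\<forall>(x, y) \<in> S. k dvd x \<and> k dvd y"
    have "k dvd fst (s * a, - r * a)"
      by (rule generate_dvd_additive[OF e1, where \<alpha> = 1 and \<beta> = 0]) (use k in auto)
    moreover have "k dvd snd (s * a, - r * a)"
      by (rule generate_dvd_additive[OF e1, where \<alpha> = 0 and \<beta> = 1]) (use k in auto)
    ultimately have "k dvd p * (s * a) + q * (- r * a)"
      by (simp del: mult_minus_left)
    moreover have "p * (s * a) + q * (- r * a) = (p * s - q * r) * a"
      by (simp add: algebra_simps)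
    ultimately show "k dvd a" using det by simp
  qed
  have minors: "a * c dvd det2 u v" if "u \<in> S" "v \<in> S" for u v
  proof -
    obtain x y x' y' where uv: "u = (x, y)" "v = (x', y')" by (cases u, cases v)
    then have *: "a dvd p * x + q * y" "c dvd r * x + s * y"
      "a dvd p * x' + q * y'" "c dvd r * x' + s * y'"
      using that L generate.incl[of _ S Z2] by blast+
    \<comment> \<open>The determinant of the transformed vectors, unchanged because the matrix has
      determinant 1.\<close>
    have "a * c dvd (p * x + q * y) * (r * x' + s * y') - (p * x' + q * y') * (r * x + s * y)"
      by (intro dvd_diff mult_dvd_mono *)
    moreover have "(p * x + q * y) * (r * x' + s * y') - (p * x' + q * y') * (r * x + s * y)
        = (p * s - q * r) * det2 u v"
      by (simp add: uv algebra_simps)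
    ultimately show ?thesis using det by simp
  qed
  show "k dvd a * c \<longleftrightarrow> (\<forall>u \<in> S. \<forall>v \<in> S. k dvd det2 u v)"
  proof
    assume "k dvd a * c"
    then show "\<forall>u \<in> S. \<forall>v \<in> S. k dvd det2 u v"
      using minors by (auto intro: dvd_trans)
  next
    assume "\<forall>u \<in> S. \<forall>v \<in> S. k dvd det2 u v"
    then have "k dvd det2 (s * a, - r * a) (- q * c, p * c)"
      using generate_dvd_det2[OF e1 e2] by blast
    moreover have "det2 (s * a, - r * a) (- q * c, p * c) = (p * s - q * r) * (a * c)"
      by (simp add: algebra_simps)
    ultimately show "k dvd a * c" using det by simp
  qed
qed

section \<open>The lattice of vacua\<close>

lemma dvd_minors_gcd_iff:
  fixes N d m t n k :: int
  assumes "d \<ge> 1" "d dvd N" "m \<ge> 1" "m dvd N"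
  shows "k dvd minors_gcd N d m t n \<longleftrightarrow>
    (\<forall>u \<in> {(d, 0), (t, N div d), (m, 0), (- n, N div m)}.
     \<forall>v \<in> {(d, 0), (t, N div d), (m, 0), (- n, N div m)}. k dvd det2 u v)"
proof -
  obtain D M where D: "N = d * D" and M: "N = m * M"
    using assms by blast
  have div: "N div d = D" "N div m = M"
    using D M assms by auto
  have eq: "N * d = m * (d * M)" "N * m = d * (m * D)"
    using M D by (simp_all add: mult.commute mult.left_commute)
  have "N * d div m = d * M" "N * m div d = m * D"
    unfolding eq using assms by simp_all
  then have gcd: "k dvd minors_gcd N d m t n \<longleftrightarrow> k dvd d * M \<and> k dvd m * D \<and> k dvd M * t + D * n"
    by (simp add: minors_gcd_def div)
  \<comment> \<open>Needed for the minors of the first two and of the last two generators, both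
    equal to \<open>N\<close>. Squares are compared: \<open>k^2\<close> divides
    \<open>N^2\<close>.\<close>
  have N: "k dvd N" if "k dvd d * M" "k dvd m * D"
  proof -
    have "k * k dvd (d * M) * (m * D)"
      using that by (rule mult_dvd_mono)
    also have "\<dots> = (d * D) * (m * M)"
      by (simp add: ac_simps)
    also have "\<dots> = N * N"
      by (simp flip: D M)
    finally have "k ^ 2 dvd N ^ 2" by (simp add: power2_eq_square)
    then show ?thesis by (simp add: pow_divides_pow_iff)
  qed
  \<comment> \<open>The minor of the second and fourth generators, in both orders.\<close>
  have minus: "k dvd t * M + D * n \<longleftrightarrow> k dvd M * t + D * n"
    "k dvd - (n * D) - M * t \<longleftrightarrow> k dvd M * t + D * n"
    using dvd_minus_iff[of k "M * t + D * n"] by (simp_all add: algebra_simps)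
  show ?thesis
    unfolding gcd div using N D M minus by (auto simp: mult.commute)
qed

theorem mainTheorem4:
  fixes N d m t n :: int
  assumes "N \<ge> 1"
    and "d \<ge> 1" and "d dvd N"
    and "m \<ge> 1" and "m dvd N"
    and "0 \<le> t" and "t \<le> d - 1"
  shows "int (card (rcosets\<^bsub>Z2\<^esub> (vacua_lattice N d m t n))) = minors_gcd N d m t n
    \<and> (\<exists>e1 e2 :: nat. e1 > 0 \<and> e2 > 0
           \<and> int e1 = Gcd {d, m, N div d, N div m, t, n}
           \<and> int e1 * int e2 = minors_gcd N d m t n
           \<and> Z2 Mod (vacua_lattice N d m t n) \<cong> integer_mod_group e1 \<times>\<times> integer_mod_group e2)"
proof -
  let ?S = "{(d, 0), (t, N div d), (m, 0), (- n, N div m)}"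
  interpret plane_lattice "generate Z2 ?S"
    by (rule plane_lattice_generate)
  obtain p q r s a c where det: "p * s - q * r = (1::int)" and ac: "a \<ge> 0" "c \<ge> 0" "a dvd c"
    and L: "\<And>x y. (x, y) \<in> generate Z2 ?S \<longleftrightarrow> a dvd p * x + q * y \<and> c dvd r * x + s * y"
    by (rule smith_normal_form) blast
  note invariants = normal_form_invariants[OF det ac(3) L]
  \<comment> \<open>Nonnegative integers with the same divisors are equal; the same argument
    identifies \<open>a\<close> below.\<close>
  have "k dvd a * c \<longleftrightarrow> k dvd minors_gcd N d m t n" for k
    using invariants(2) dvd_minors_gcd_iff[OF assms(2-5)] by simp
  moreover have "minors_gcd N d m t n \<ge> 0"
    by (simp add: minors_gcd_def)
  ultimately have prod: "a * c = minors_gcd N d m t n"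
    using ac by (metis dvd_refl mult_nonneg_nonneg zdvd_antisym_nonneg)
  have "k dvd a \<longleftrightarrow> k dvd Gcd {d, m, N div d, N div m, t, n}" for k
    using invariants(1)[of k] by auto
  then have content: "a = Gcd {d, m, N div d, N div m, t, n}"
    using ac by (metis dvd_refl Gcd_int_greater_eq_0 zdvd_antisym_nonneg)
  \<comment> \<open>One nonzero minor forces \<open>a * c\<close> to be nonzero, hence the quotient
    to be finite.\<close>
  have "N * d div m > 0"
  proof -
    have "m \<le> N * d"
      using assms zdvd_imp_le[of m "N * d"] by simp
    then show ?thesis using assms by (simp add: pos_imp_zdiv_pos_iff)
  qed
  then have "minors_gcd N d m t n \<noteq> 0"
    by (auto simp: minors_gcd_def)
  then have pos: "a > 0" "c > 0"
    using prod ac by (auto simp: order_less_le)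
  have q: "Z2 Mod (vacua_lattice N d m t n) \<cong> integer_mod_group (nat a) \<times>\<times> integer_mod_group (nat c)"
    "card (rcosets\<^bsub>Z2\<^esub> (vacua_lattice N d m t n)) = nat a * nat c"
    using quotient_of_normal_form[OF det, of "nat a" "nat c" "generate Z2 ?S"] pos L
    unfolding vacua_lattice_def by auto
  show ?thesis
    using q pos prod content
    by (intro conjI exI[of _ "nat a"] exI[of _ "nat c"]) (simp_all del: Gcd_insert)
qed

end
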